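(* Fix $\alpha\in(0,1)$, $\sigma_Z\ge 0$ and a constant $c>0$. For each $\beta\in(0,1)$ let $\sigma_\beta=\sqrt{\beta^2+(1-\beta)^2}$ and let the university with preference parameter $\beta$ use the quality threshold $\tau_Q=c\,\sigma_\beta$ (so that $\tau_Q/\sigma_\beta=c>0$ is held fixed as $\beta$ varies). Then, as functions of $\beta\in(0,1)$, the average type and the average soft skill of admitted students are both lowest at $\beta=\alpha$, and both monotonically increase as $\beta$ moves away from $\alpha$; that is, both are monotonically decreasing in $\beta$ on $(0,\alpha]$ and monotonically increasing in $\beta$ on $[\alpha,1)$.
   Context: A student has a type $t$ and a soft skill $s$; $t,s,Z$ are mutually independent standard normal random variables. The university observes only the admission score $A=\alpha t+(1-\alpha)s+\sigma_Z Z$. With preference parameter $\beta\in(0,1)$ it measures student quality by $Q=\beta t+(1-\beta)s$. With quality threshold $\tau_Q$, it admits a student with score $A=a$ if and only if $\mathbb{E}[Q\mid A=a]\ge\tau_Q$. Equivalently, with $\sigma_\alpha=\sqrt{\alpha^2+(1-\alpha)^2+\sigma_Z^2}$, it admits iff $A\ge\tau_A:=\dfrac{\tau_Q\sigma_\alpha^2}{\alpha\beta+(1-\alpha)(1-\beta)}$. The average type and the average soft skill of admitted students are $\mathbb{E}[t\mid A\ge\tau_A]$ and $\mathbb{E}[s\mid A\ge\tau_A]$. *)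

theory Defs
  imports "HOL-Probability.Probability"
begin

definition admission_score ::
    "real \<Rightarrow> real \<Rightarrow> ('w \<Rightarrow> real) \<Rightarrow> ('w \<Rightarrow> real) \<Rightarrow> ('w \<Rightarrow> real) \<Rightarrow> 'w \<Rightarrow> real" where
  "admission_score \<alpha> \<sigma>\<^sub>Z t s Z \<omega> = \<alpha> * t \<omega> + (1 - \<alpha>) * s \<omega> + \<sigma>\<^sub>Z * Z \<omega>"

definition student_quality :: "real \<Rightarrow> ('w \<Rightarrow> real) \<Rightarrow> ('w \<Rightarrow> real) \<Rightarrow> 'w \<Rightarrow> real" where
  "student_quality \<beta> t s \<omega> = \<beta> * t \<omega> + (1 - \<beta>) * s \<omega>"

text \<open>
  The event that the student is admitted. Conditioning on the score is conditioning on the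
  sigma-algebra it generates, so \<open>real_cond_exp\<close> below is a version of \<open>E[Q | A]\<close> and a
  function of the score alone. Versions agree almost everywhere, so the choice does not affect
  averages over this event.
\<close>
definition admitted :: "'w measure \<Rightarrow> ('w \<Rightarrow> real) \<Rightarrow> ('w \<Rightarrow> real) \<Rightarrow> real \<Rightarrow> 'w set" where
  "admitted M A Q \<tau> =
     {\<omega> \<in> space M. \<tau> \<le> real_cond_exp M (vimage_algebra (space M) A borel) Q \<omega>}"

text \<open>\<open>E[X | E]\<close> for an event \<open>E\<close> of positive probability.\<close>
definition event_expectation :: "'w measure \<Rightarrow> ('w \<Rightarrow> real) \<Rightarrow> 'w set \<Rightarrow> real" where
  "event_expectation M X E = (\<integral>\<omega>. X \<omega> \<partial>uniform_measure M E)"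

definition quality_sd :: "real \<Rightarrow> real" where
  "quality_sd \<beta> = sqrt (\<beta>\<^sup>2 + (1 - \<beta>)\<^sup>2)"

definition admitted_average ::
    "'w measure \<Rightarrow> ('w \<Rightarrow> real) \<Rightarrow> ('w \<Rightarrow> real) \<Rightarrow> ('w \<Rightarrow> real) \<Rightarrow> real \<Rightarrow> real \<Rightarrow> real \<Rightarrow>
      ('w \<Rightarrow> real) \<Rightarrow> real \<Rightarrow> real" where
  "admitted_average M t s Z \<alpha> \<sigma>\<^sub>Z c X \<beta> =
     event_expectation M X
       (admitted M (admission_score \<alpha> \<sigma>\<^sub>Z t s Z) (student_quality \<beta> t s) (c * quality_sd \<beta>))"

end

theory Submission
  imports Defs
begin

text \<open>
  The score is a sum of two independent centred normals, one of them proportional to the type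
  (or to the soft skill). Factorising the joint density shows that \<open>E[t | A]\<close>, \<open>E[s | A]\<close> and
  \<open>E[Q | A]\<close> are multiples of \<open>A\<close>, with factors proportional to \<open>\<alpha>\<close>, \<open>1 - \<alpha>\<close> and
  \<open>L = \<alpha>\<beta> + (1 - \<alpha>)(1 - \<beta>)\<close>. So both averages are positive multiples of \<open>E[A | A \<ge> \<tau>]\<close>, which
  is strictly increasing in \<open>\<tau>\<close>, and \<open>\<tau>\<close> is proportional to \<open>\<sigma>\<^sub>\<beta> / L\<close>. By Lagrange's identity
  \<open>(\<alpha>\<^sup>2 + (1 - \<alpha>)\<^sup>2) \<sigma>\<^sub>\<beta>\<^sup>2 = L\<^sup>2 + (\<beta> - \<alpha>)\<^sup>2\<close>, and \<open>(\<beta> - \<alpha>) / L\<close> is strictly increasing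
  in \<open>\<beta>\<close> and vanishes at \<open>\<alpha>\<close>.
\<close>

section \<open>Regression of a normal summand on the sum\<close>

text \<open>Completing the square in \<open>x\<close>. The left side is the joint density of
  \<open>(X, X + W)\<close> at \<open>(x, y)\<close>; the right side splits it into the marginal
  density of the sum and the conditional density of \<open>X\<close> given the sum, whose mean is
  linear in \<open>y\<close>.\<close>

lemma normal_density_mult_convolution:
  fixes a w x y :: real
  assumes "0 < a" "0 < w"
  defines "\<sigma> \<equiv> sqrt (a\<^sup>2 + w\<^sup>2)"
  shows "normal_density 0 a x * normal_density 0 w (y - x) =
    normal_density 0 \<sigma> y * normal_density (a\<^sup>2 / \<sigma>\<^sup>2 * y) (a * w / \<sigma>) x"
proof -
  have pos: "0 < \<sigma>" and sq: "\<sigma>\<^sup>2 = a\<^sup>2 + w\<^sup>2"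
    using assms by (auto simp: sum_power2_gt_zero_iff)
  have nz: "a \<noteq> 0" "w \<noteq> 0" "\<sigma> \<noteq> 0" using assms pos by auto
  \<comment> \<open>The completed square with denominators cleared; the remainder depends on
    \<open>y\<close> only. The next two steps bring both exponents to this common form.\<close>
  have "(\<sigma>\<^sup>2 * x - a\<^sup>2 * y)\<^sup>2 + a\<^sup>2 * w\<^sup>2 * y\<^sup>2 = \<sigma>\<^sup>2 * (w\<^sup>2 * x\<^sup>2 + a\<^sup>2 * (y - x)\<^sup>2)"
    unfolding sq by algebra
  moreover have "y\<^sup>2 / (2 * \<sigma>\<^sup>2) + (x - a\<^sup>2 / \<sigma>\<^sup>2 * y)\<^sup>2 / (2 * (a * w / \<sigma>)\<^sup>2) =
    ((\<sigma>\<^sup>2 * x - a\<^sup>2 * y)\<^sup>2 + a\<^sup>2 * w\<^sup>2 * y\<^sup>2) / (\<sigma>\<^sup>2 * (2 * a\<^sup>2 * w\<^sup>2))"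
  proof -
    have "x - a\<^sup>2 / \<sigma>\<^sup>2 * y = (\<sigma>\<^sup>2 * x - a\<^sup>2 * y) / \<sigma>\<^sup>2"
      using nz by (simp add: field_simps)
    then show ?thesis using nz by (simp add: field_simps power_divide power_mult_distrib)
  qed
  moreover have "x\<^sup>2 / (2 * a\<^sup>2) + (y - x)\<^sup>2 / (2 * w\<^sup>2) =
     (\<sigma>\<^sup>2 * (w\<^sup>2 * x\<^sup>2 + a\<^sup>2 * (y - x)\<^sup>2)) / (\<sigma>\<^sup>2 * (2 * a\<^sup>2 * w\<^sup>2))"
    using nz by (simp add: field_simps)
  ultimately have expo: "x\<^sup>2 / (2 * a\<^sup>2) + (y - x)\<^sup>2 / (2 * w\<^sup>2) =
      y\<^sup>2 / (2 * \<sigma>\<^sup>2) + (x - a\<^sup>2 / \<sigma>\<^sup>2 * y)\<^sup>2 / (2 * (a * w / \<sigma>)\<^sup>2)"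
    by simp
  have const: "sqrt (2 * pi * a\<^sup>2) * sqrt (2 * pi * w\<^sup>2) =
      sqrt (2 * pi * \<sigma>\<^sup>2) * sqrt (2 * pi * (a * w / \<sigma>)\<^sup>2)"
    unfolding real_sqrt_mult[symmetric] using nz
    by (intro arg_cong[where f = sqrt]) (simp add: power_divide power_mult_distrib)
  show ?thesis
    unfolding normal_density_def
    using expo const
    by (simp add: exp_add[symmetric] add.commute flip: mult.assoc)
qed

text \<open>Integrated form of the linear regression of \<open>X\<close> on \<open>X + W\<close>:
  testing against all events determined by the sum is what characterises a conditional expectation.
  After the shear \<open>y = x + w\<close> and a change of the order of integration, the inner
  integral is the mean of the conditional normal density.\<close>

lemma (in prob_space) indep_normal_sum_regression:
  fixes X W :: "'a \<Rightarrow> real" and B :: "real set"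
  assumes a: "0 < a" and w: "0 < w"
    and X: "distributed M lborel X (normal_density 0 a)"
    and W: "distributed M lborel W (normal_density 0 w)"
    and indep: "indep_var borel X borel W"
    and B[measurable]: "B \<in> sets borel"
  shows "expectation (\<lambda>\<omega>. X \<omega> * indicator B (X \<omega> + W \<omega>)) =
    a\<^sup>2 / (a\<^sup>2 + w\<^sup>2) * expectation (\<lambda>\<omega>. (X \<omega> + W \<omega>) * indicator B (X \<omega> + W \<omega>))"
proof -
  define \<sigma> where "\<sigma> = sqrt (a\<^sup>2 + w\<^sup>2)"
  define k where "k = a\<^sup>2 / \<sigma>\<^sup>2"
  have \<sigma>: "0 < \<sigma>" "\<sigma>\<^sup>2 = a\<^sup>2 + w\<^sup>2"
    using a w by (auto simp: \<sigma>_def sum_power2_gt_zero_iff)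
  have [measurable]: "X \<in> borel_measurable M" "W \<in> borel_measurable M"
    using distributed_measurable[OF X] distributed_measurable[OF W] by simp_all
  have pair: "distributed M (lborel \<Otimes>\<^sub>M lborel) (\<lambda>\<omega>. (X \<omega>, W \<omega>))
      (\<lambda>(x, y). normal_density 0 a x * normal_density 0 w y)"
  proof -
    have "indep_var lborel X lborel W"
      using indep unfolding indep_var_eq by simp
    from distributed_joint_indep[OF lborel.sigma_finite_measure_axioms
        lborel.sigma_finite_measure_axioms X W this]
    show ?thesis by (simp add: ennreal_mult'' case_prod_unfold)
  qed
  have sum: "distributed M lborel (\<lambda>\<omega>. X \<omega> + W \<omega>) (normal_density 0 \<sigma>)"
    using add_indep_normal[OF indep a w X W] by (simp add: \<sigma>_def)
  have intX: "integrable M X"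
    using X by (rule distributed_integrable_var) (use integrable_normal_moment_nz_1[OF a] in auto)
  define g where "g = (\<lambda>(x, y). x * indicator B (x + y) :: real)"
  have [measurable]: "g \<in> borel_measurable (lborel \<Otimes>\<^sub>M lborel)"
    unfolding g_def by measurable
  have "integrable M (\<lambda>\<omega>. X \<omega> * indicator B (X \<omega> + W \<omega>))"
    by (rule Bochner_Integration.integrable_bound[OF intX]) (auto simp: indicator_def)
  then have intg: "integrable M (\<lambda>\<omega>. g (X \<omega>, W \<omega>))" by (simp add: g_def)
  define h where "h = (\<lambda>p. (case p of (x, y) \<Rightarrow> normal_density 0 a x * normal_density 0 w y) * g p)"
  have inth: "integrable (lborel \<Otimes>\<^sub>M lborel) h"
    using distributed_integrable[OF pair, of g] intg unfolding h_def by auto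
  \<comment> \<open>The integrand after the shear, without the indicator. Its integrability is shown
    first; the bounded factor \<open>indicator B y\<close> then costs nothing.\<close>
  define F where "F = (\<lambda>(x, y). x * normal_density 0 a x * normal_density 0 w (y - x))"
  have shift: "(\<integral>y. f (y - x) \<partial>lborel) = (\<integral>y. f y \<partial>lborel)" for f :: "real \<Rightarrow> real" and x
    using lborel_integral_real_affine[of 1 "\<lambda>y. f (y - x)" x] by simp
  have intshift: "integrable lborel (\<lambda>y. normal_density 0 w (y - x))" for x
    using lborel_integrable_real_affine[OF integrable_normal_density[OF w, of 0], of 1 "-x"] by simp
  have intF: "integrable (lborel \<Otimes>\<^sub>M lborel) F"
  proof (rule lborel_pair.Fubini_integrable)
    show "F \<in> borel_measurable (lborel \<Otimes>\<^sub>M lborel)" unfolding F_def by measurable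
    \<comment> \<open>The second density integrates to 1 in \<open>y\<close>. The form
      \<open>\<bar>x - 0\<bar> ^ 1\<close> is that of the absolute moments of a normal
      density.\<close>
    have "(\<integral>y. norm (F (x, y)) \<partial>lborel) = normal_density 0 a x * \<bar>x - 0\<bar> ^ 1" for x
      unfolding F_def using shift[of "normal_density 0 w" x] w
      by (simp add: abs_mult)
    then show "integrable lborel (\<lambda>x. \<integral>y. norm (F (x, y)) \<partial>lborel)"
      using integrable_normal_moment_abs[OF a, of 0 1] by simp
    show "AE x in lborel. integrable lborel (\<lambda>y. F (x, y))"
      unfolding F_def using intshift by simp
  qed
  then have intFB: "integrable (lborel \<Otimes>\<^sub>M lborel) (\<lambda>(x, y). F (x, y) * indicator B y)"
    by (rule Bochner_Integration.integrable_bound) (auto simp: F_def indicator_def)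
  have "expectation (\<lambda>\<omega>. X \<omega> * indicator B (X \<omega> + W \<omega>)) = integral\<^sup>L (lborel \<Otimes>\<^sub>M lborel) h"
    using distributed_integral[OF pair, of g] unfolding h_def by (auto simp: g_def)
  also have "\<dots> = (\<integral>x. \<integral>y. h (x, y) \<partial>lborel \<partial>lborel)"
    using lborel_pair.integral_fst'[OF inth] by simp
  also have "\<dots> = (\<integral>x. \<integral>y. F (x, y) * indicator B y \<partial>lborel \<partial>lborel)"
  proof (rule Bochner_Integration.integral_cong[OF refl])
    fix x :: real
    have "(\<integral>y. h (x, y) \<partial>lborel) = (\<integral>y. h (x, y - x) \<partial>lborel)"
      by (rule shift[symmetric])
    also have "\<dots> = (\<integral>y. F (x, y) * indicator B y \<partial>lborel)"
      by (rule Bochner_Integration.integral_cong) (auto simp: h_def g_def F_def)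
    finally show "(\<integral>y. h (x, y) \<partial>lborel) = (\<integral>y. F (x, y) * indicator B y \<partial>lborel)" .
  qed
  also have "\<dots> = (\<integral>y. \<integral>x. F (x, y) * indicator B y \<partial>lborel \<partial>lborel)"
    using lborel_pair.Fubini_integral[OF intFB] by simp
  also have "\<dots> = (\<integral>y. normal_density 0 \<sigma> y * (k * (y * indicator B y)) \<partial>lborel)"
  proof (rule Bochner_Integration.integral_cong[OF refl])
    fix y :: real
    \<comment> \<open>For fixed \<open>y\<close> the factor of the sum comes out of the integral,
      and what remains is the mean \<open>k * y\<close> of a normal density.\<close>
    have "F (x, y) = normal_density 0 \<sigma> y * (normal_density (k * y) (a * w / \<sigma>) x * x)" for x
      using normal_density_mult_convolution[OF a w, of x y, folded \<sigma>_def k_def]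
      by (simp add: F_def mult_ac)
    then show "(\<integral>x. F (x, y) * indicator B y \<partial>lborel) = normal_density 0 \<sigma> y * (k * (y * indicator B y))"
      using integral_normal_moment_nz_1[of "a * w / \<sigma>" "k * y"] a w \<sigma> by simp
  qed
  also have "\<dots> = expectation (\<lambda>\<omega>. k * ((X \<omega> + W \<omega>) * indicator B (X \<omega> + W \<omega>)))"
    by (rule distributed_integral[OF sum]) auto
  finally show ?thesis by (simp add: k_def \<sigma>)
qed

section \<open>Averages over upper tails of a normal variable\<close>

text \<open>A normal density vanishes nowhere. The bound keeps the denominators of tail averages
  positive and later makes their comparison strict.\<close>

lemma (in prob_space) normal_prob_interval_pos:
  fixes A :: "'a \<Rightarrow> real"
  assumes A: "distributed M lborel A (normal_density 0 \<sigma>)" and "0 < \<sigma>" and ab: "a < b"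
  shows "0 < prob {\<omega> \<in> space M. a \<le> A \<omega> \<and> A \<omega> < b}"
proof -
  have "emeasure M (A -` {a..<b} \<inter> space M)
      = (\<integral>\<^sup>+x. ennreal (normal_density 0 \<sigma> x) * indicator {a..<b} x \<partial>lborel)"
    by (rule distributed_emeasure[OF A]) auto
  moreover have "\<dots> \<noteq> 0"
  proof
    assume "(\<integral>\<^sup>+x. ennreal (normal_density 0 \<sigma> x) * indicator {a..<b} x \<partial>lborel) = 0"
    then have "AE x in lborel. ennreal (normal_density 0 \<sigma> x) * indicator {a..<b} x = 0"
      by (subst (asm) nn_integral_0_iff_AE) auto
    then have "AE x in lborel. x \<notin> {a..<b}"
    proof eventually_elim
      fix x assume "ennreal (normal_density 0 \<sigma> x) * indicator {a..<b} x = 0"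
      then show "x \<notin> {a..<b}"
        using normal_density_pos[OF \<open>0 < \<sigma>\<close>, of 0 x] by (auto simp: indicator_def ennreal_eq_0_iff)
    qed
    then have "emeasure lborel {a..<b} = 0"
      by (subst (asm) AE_iff_measurable[of "{a..<b}"]) auto
    then show False using ab by simp
  qed
  moreover have "A -` {a..<b} \<inter> space M = {\<omega> \<in> space M. a \<le> A \<omega> \<and> A \<omega> < b}" by auto
  ultimately show ?thesis
    by (metis emeasure_eq_measure ennreal_0 zero_less_measure_iff)
qed

lemma event_expectation_eq:
  fixes M :: "'w measure"
  assumes "prob_space M" and [measurable]: "X \<in> borel_measurable M" "E \<in> sets M"
    and pos: "0 < measure M E"
  shows "event_expectation M X E = (\<integral>\<omega>. X \<omega> * indicator E \<omega> \<partial>M) / measure M E"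
proof -
  interpret prob_space M by fact
  have "uniform_measure M E = density M (\<lambda>\<omega>. ennreal (indicator E \<omega> / measure M E))"
    unfolding uniform_measure_def using pos
    by (intro density_cong) (auto simp: emeasure_eq_measure divide_ennreal indicator_def simp flip: ennreal_1)
  then have "event_expectation M X E = (\<integral>\<omega>. indicator E \<omega> / measure M E * X \<omega> \<partial>M)"
    unfolding event_expectation_def by (simp add: integral_density)
  also have "\<dots> = (\<integral>\<omega>. X \<omega> * indicator E \<omega> / measure M E \<partial>M)"
    by (simp add: mult_ac)
  finally show ?thesis by simp
qed

lemma event_expectation_cong_AE:
  fixes M :: "'w measure"
  assumes "prob_space M" and [measurable]: "E \<in> sets M" "E' \<in> sets M"
    and "AE \<omega> in M. \<omega> \<in> E \<longleftrightarrow> \<omega> \<in> E'"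
  shows "event_expectation M X E = event_expectation M X E'"
proof -
  have "emeasure M E = emeasure M E'" using assms(4) by (intro emeasure_eq_AE) auto
  then have "uniform_measure M E = uniform_measure M E'"
    unfolding uniform_measure_def using assms(4)
    by (intro density_cong) (auto simp: indicator_def)
  then show ?thesis by (simp add: event_expectation_def)
qed

text \<open>Raising the threshold from \<open>a\<close> to \<open>b\<close> discards outcomes whose
  values lie below \<open>b\<close>, while the average of those kept exceeds \<open>b\<close>; so
  the average goes up.\<close>

lemma (in prob_space) normal_tail_expectation_strict_mono:
  fixes A :: "'a \<Rightarrow> real"
  assumes A: "distributed M lborel A (normal_density 0 \<sigma>)" and \<sigma>: "0 < \<sigma>" and ab: "a < b"
  shows "event_expectation M A {\<omega> \<in> space M. a \<le> A \<omega>} <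
    event_expectation M A {\<omega> \<in> space M. b \<le> A \<omega>}"
proof -
  have [measurable]: "A \<in> borel_measurable M" using distributed_measurable[OF A] by simp
  have int: "integrable M A"
    using A by (rule distributed_integrable_var) (use integrable_normal_moment_nz_1[OF \<sigma>] in auto)
  \<comment> \<open>\<open>P\<close> is kept and \<open>Q\<close> is discarded. \<open>U\<close> is
    a part of \<open>P\<close> of positive probability on which \<open>A\<close> exceeds
    \<open>b\<close> by at least 1; it makes the bound on \<open>NP\<close> strict.\<close>
  define P Q U where "P = {\<omega> \<in> space M. b \<le> A \<omega>}" and "Q = {\<omega> \<in> space M. a \<le> A \<omega> \<and> A \<omega> < b}"
    and "U = {\<omega> \<in> space M. b + 1 \<le> A \<omega> \<and> A \<omega> < b + 2}"
  have [measurable]: "P \<in> sets M" "Q \<in> sets M" "U \<in> sets M"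
      unfolding P_def Q_def U_def by measurable
  have PQ: "{\<omega> \<in> space M. a \<le> A \<omega>} = P \<union> Q" "P \<inter> Q = {}"
    unfolding P_def Q_def using ab by auto
  have pQ: "0 < prob Q" and pU: "0 < prob U"
    unfolding Q_def U_def using ab by (auto intro!: normal_prob_interval_pos[OF A \<sigma>])
  have UP: "U \<subseteq> P" unfolding U_def P_def by auto
  then have pP: "0 < prob P" using pU finite_measure_mono[of U P] by simp
  have pPQ: "prob (P \<union> Q) = prob P + prob Q" using PQ(2) by (simp add: finite_measure_Union)
  have intI: "integrable M (\<lambda>\<omega>. A \<omega> * indicator E \<omega>)" if "E \<in> sets M" for E
    using integrable_real_mult_indicator[OF that int] by simp
  have intC: "integrable M (\<lambda>\<omega>. r * indicator E \<omega>)" if "E \<in> sets M" for E and r :: real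
    using that by (simp add: less_top[symmetric])
  define NP NQ where "NP = expectation (\<lambda>\<omega>. A \<omega> * indicator P \<omega>)"
    and "NQ = expectation (\<lambda>\<omega>. A \<omega> * indicator Q \<omega>)"
  have NPQ: "expectation (\<lambda>\<omega>. A \<omega> * indicator (P \<union> Q) \<omega>) = NP + NQ"
    unfolding NP_def NQ_def
    by (subst Bochner_Integration.integral_add[symmetric])
      (auto simp: intI indicator_add[OF PQ(2), symmetric] distrib_left)
  have NQ: "NQ \<le> b * prob Q"
  proof -
    have "NQ \<le> expectation (\<lambda>\<omega>. b * indicator Q \<omega>)"
      unfolding NQ_def by (intro integral_mono intI intC) (auto simp: Q_def indicator_def)
    then show ?thesis by simp
  qed
  have NP: "b * prob P < NP"
  proof -
    have "expectation (\<lambda>\<omega>. b * indicator P \<omega> + 1 * indicator U \<omega>) \<le> NP"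
      unfolding NP_def by (intro integral_mono intI intC Bochner_Integration.integrable_add)
      (auto simp: P_def U_def indicator_def)
    also have "expectation (\<lambda>\<omega>. b * indicator P \<omega> + 1 * indicator U \<omega>) = b * prob P + 1 * prob U"
      by (subst Bochner_Integration.integral_add) (use intC[of P b] intC[of U 1] in auto)
    finally show ?thesis using pU by simp
  qed
  \<comment> \<open>The claim with denominators cleared: the average over \<open>Q\<close> is at
    most \<open>b\<close>, which is less than the average over \<open>P\<close>.\<close>
  have "(NP + NQ) * prob P < NP * (prob P + prob Q)"
  proof -
    have "NQ * prob P \<le> b * prob Q * prob P" using NQ pP by simp
    also have "\<dots> < NP * prob Q" using mult_strict_right_mono[OF NP pQ] by (simp add: mult_ac)
    finally show ?thesis by (simp add: algebra_simps)
  qed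
  then have "(NP + NQ) / (prob P + prob Q) < NP / prob P"
    using pP pQ by (simp add: divide_simps mult_ac)
  then show ?thesis
    unfolding PQ(1) P_def[symmetric] using pP pQ pPQ NPQ
    by (simp add: event_expectation_eq prob_space_axioms NP_def)
qed

section \<open>The threshold as a function of the preference parameter\<close>

text \<open>The covariance of score and quality, and the inner product of the weight vectors
  \<open>(\<alpha>, 1 - \<alpha>)\<close> and \<open>(\<beta>, 1 - \<beta>)\<close>.\<close>

definition alignment :: "real \<Rightarrow> real \<Rightarrow> real" where
  "alignment \<alpha> \<beta> = \<alpha> * \<beta> + (1 - \<alpha>) * (1 - \<beta>)"

lemma alignment_pos: "0 < \<alpha> \<Longrightarrow> \<alpha> < 1 \<Longrightarrow> 0 < \<beta> \<Longrightarrow> \<beta> < 1 \<Longrightarrow> 0 < alignment \<alpha> \<beta>"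
  unfolding alignment_def by (simp add: add_pos_pos)

text \<open>The ratio is the tangent of the signed angle between the two weight vectors. After
  cross-multiplication the difference of the two sides is \<open>y - x\<close> times the squared
  length of \<open>(\<alpha>, 1 - \<alpha>)\<close>.\<close>

lemma alignment_ratio_strict_mono:
  assumes "0 < \<alpha>" "\<alpha> < 1" "0 < x" "x < y" "y < 1"
  shows "(x - \<alpha>) / alignment \<alpha> x < (y - \<alpha>) / alignment \<alpha> y"
proof -
  have "(y - \<alpha>) * alignment \<alpha> x - (x - \<alpha>) * alignment \<alpha> y = (y - x) * (\<alpha>\<^sup>2 + (1 - \<alpha>)\<^sup>2)"
    unfolding alignment_def by algebra
  moreover have "0 < (y - x) * (\<alpha>\<^sup>2 + (1 - \<alpha>)\<^sup>2)"
    using assms by (intro mult_pos_pos add_pos_pos) auto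
  ultimately show ?thesis
    using alignment_pos[of \<alpha> x] alignment_pos[of \<alpha> y] assms by (simp add: divide_simps)
qed

text \<open>The secant of that angle, expressed through its tangent and divided by the length of
  \<open>(\<alpha>, 1 - \<alpha>)\<close>. Only the square of the monotone ratio remains.\<close>

lemma quality_sd_over_alignment:
  assumes "0 < \<alpha>" "\<alpha> < 1" "0 < \<beta>" "\<beta> < 1"
  shows "quality_sd \<beta> / alignment \<alpha> \<beta> =
    sqrt ((1 + ((\<beta> - \<alpha>) / alignment \<alpha> \<beta>)\<^sup>2) / (\<alpha>\<^sup>2 + (1 - \<alpha>)\<^sup>2))"
proof -
  note p = alignment_pos[OF assms]
  have n: "0 < \<alpha>\<^sup>2 + (1 - \<alpha>)\<^sup>2" using assms by (intro add_pos_pos) auto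
  have lagrange: "(\<alpha>\<^sup>2 + (1 - \<alpha>)\<^sup>2) * (\<beta>\<^sup>2 + (1 - \<beta>)\<^sup>2) = (alignment \<alpha> \<beta>)\<^sup>2 + (\<beta> - \<alpha>)\<^sup>2"
    unfolding alignment_def by algebra
  have "1 + ((\<beta> - \<alpha>) / alignment \<alpha> \<beta>)\<^sup>2 =
      ((alignment \<alpha> \<beta>)\<^sup>2 + (\<beta> - \<alpha>)\<^sup>2) / (alignment \<alpha> \<beta>)\<^sup>2"
    using p by (simp add: power_divide add_divide_distrib)
  then have "(\<beta>\<^sup>2 + (1 - \<beta>)\<^sup>2) / (alignment \<alpha> \<beta>)\<^sup>2 =
      (1 + ((\<beta> - \<alpha>) / alignment \<alpha> \<beta>)\<^sup>2) / (\<alpha>\<^sup>2 + (1 - \<alpha>)\<^sup>2)"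
    unfolding lagrange[symmetric] using n by simp
  moreover have "quality_sd \<beta> / alignment \<alpha> \<beta> = sqrt ((\<beta>\<^sup>2 + (1 - \<beta>)\<^sup>2) / (alignment \<alpha> \<beta>)\<^sup>2)"
    using p by (simp add: quality_sd_def real_sqrt_divide)
  ultimately show ?thesis by simp
qed

text \<open>The last assumption says that \<open>y\<close> lies beyond \<open>x\<close> on one side
  of \<alpha>, where \<open>x\<close> may be \<alpha> itself. On either side the monotone ratio,
  zero at \<alpha>, then has the larger absolute value at \<open>y\<close>.\<close>

lemma quality_sd_over_alignment_less:
  assumes "0 < \<alpha>" "\<alpha> < 1" "0 < x" "x < 1" "0 < y" "y < 1"
    and "x < y \<and> \<alpha> \<le> x \<or> y < x \<and> x \<le> \<alpha>"
  shows "quality_sd x / alignment \<alpha> x < quality_sd y / alignment \<alpha> y"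
proof -
  have n: "0 < \<alpha>\<^sup>2 + (1 - \<alpha>)\<^sup>2" using assms by (intro add_pos_pos) auto
  note p = alignment_pos[of \<alpha> x, OF assms(1-4)] alignment_pos[of \<alpha> y, OF assms(1,2,5,6)]
  have "((x - \<alpha>) / alignment \<alpha> x)\<^sup>2 < ((y - \<alpha>) / alignment \<alpha> y)\<^sup>2"
  proof -
    have "\<bar>(x - \<alpha>) / alignment \<alpha> x\<bar> < \<bar>(y - \<alpha>) / alignment \<alpha> y\<bar>"
      using assms(7)
    proof
      assume h: "x < y \<and> \<alpha> \<le> x"
      then have "0 \<le> (x - \<alpha>) / alignment \<alpha> x" using p by simp
      then show ?thesis using alignment_ratio_strict_mono[of \<alpha> x y] assms h by linarith
    next
      assume h: "y < x \<and> x \<le> \<alpha>"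
      then have "(x - \<alpha>) / alignment \<alpha> x \<le> 0" using p by (simp add: divide_nonpos_pos)
      then show ?thesis using alignment_ratio_strict_mono[of \<alpha> y x] assms h by linarith
    qed
    then show ?thesis by (simp only: abs_le_square_iff not_le[symmetric] not_False_eq_True)
  qed
  then show ?thesis
    using n by (simp add: quality_sd_over_alignment assms divide_strict_right_mono)
qed

section \<open>Conditioning on the admission score\<close>

text \<open>The case \<open>c = 0\<close>, a score without noise, is separate because a normal density with zero
  standard deviation is the zero function (division by zero).\<close>
lemma (in prob_space) indep_std_normal_component:
  fixes Y :: "nat \<Rightarrow> 'a \<Rightarrow> real"
  assumes indep: "indep_vars (\<lambda>_. borel) Y {i, j, k}"
    and distinct: "i \<noteq> j" "i \<noteq> k" "j \<noteq> k"
    and Y: "\<And>l. l \<in> {i, j, k} \<Longrightarrow> distributed M lborel (Y l) std_normal_density"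
    and a: "0 < a" and b: "0 < b" and c: "0 \<le> c"
  defines "A \<equiv> \<lambda>\<omega>. a * Y i \<omega> + b * Y j \<omega> + c * Y k \<omega>"
  shows "distributed M lborel A (normal_density 0 (sqrt (a\<^sup>2 + b\<^sup>2 + c\<^sup>2)))"
    and "B \<in> sets borel \<Longrightarrow> expectation (\<lambda>\<omega>. Y i \<omega> * indicator B (A \<omega>)) =
      a / (a\<^sup>2 + b\<^sup>2 + c\<^sup>2) * expectation (\<lambda>\<omega>. A \<omega> * indicator B (A \<omega>))"
proof -
  \<comment> \<open>With the coefficients indexed like the variables, scaling is one measurable map
    per index and so preserves independence of the family.\<close>
  define d where "d = (\<lambda>l. if l = i then a else if l = j then b else c)"
  have scaled: "indep_vars (\<lambda>_. borel) (\<lambda>l \<omega>. d l * Y l \<omega>) {i, j, k}"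
    using indep by (rule indep_vars_compose2[where Y = "\<lambda>l x. d l * x"]) simp
  define W where "W = (\<lambda>\<omega>. b * Y j \<omega> + c * Y k \<omega>)"
  have iW: "indep_var borel (\<lambda>\<omega>. a * Y i \<omega>) borel W"
    using indep_vars_sum[of "{j, k}" i "\<lambda>l \<omega>. d l * Y l \<omega>"] scaled distinct
    by (auto simp: d_def W_def)
  have normal: "distributed M lborel (\<lambda>\<omega>. q * Y l \<omega>) (normal_density 0 q)"
      if "l \<in> {i, j, k}" "0 < q" for l q
    using normal_density_affine[OF Y[OF that(1)], of q 0] that(2) by simp
  have W: "distributed M lborel W (normal_density 0 (sqrt (b\<^sup>2 + c\<^sup>2)))"
  proof (cases "c = 0")
    case True
    then show ?thesis using normal[of j b] b by (simp add: W_def)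
  next
    case False
    have "indep_vars (\<lambda>_. borel) (\<lambda>l \<omega>. d l * Y l \<omega>) {j, k}"
      by (rule indep_vars_subset[OF scaled]) auto
    then have "indep_var borel (\<lambda>\<omega>. b * Y j \<omega>) borel (\<lambda>\<omega>. c * Y k \<omega>)"
      using indep_vars_sum[of "{k}" j "\<lambda>l \<omega>. d l * Y l \<omega>"] distinct by (auto simp: d_def)
    from add_indep_normal[OF this b _ normal normal] show ?thesis
      using False b c by (simp add: W_def)
  qed
  have w: "0 < sqrt (b\<^sup>2 + c\<^sup>2)" using b by (simp add: add_pos_nonneg)
  have A: "A = (\<lambda>\<omega>. a * Y i \<omega> + W \<omega>)" by (simp add: A_def W_def add.assoc)
  have aY: "distributed M lborel (\<lambda>\<omega>. a * Y i \<omega>) (normal_density 0 a)" using normal a by simp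
  show "distributed M lborel A (normal_density 0 (sqrt (a\<^sup>2 + b\<^sup>2 + c\<^sup>2)))"
    using add_indep_normal[OF iW a w aY W] by (simp add: A add.assoc)
  assume B: "B \<in> sets borel"
  \<comment> \<open>The regression lemma applies to the summand \<open>a * Y i\<close> and yields a
    coefficient with numerator \<open>a * a\<close>; one factor \<open>a\<close> is cancelled at the
    end.\<close>
  have "a * expectation (\<lambda>\<omega>. Y i \<omega> * indicator B (A \<omega>)) =
      expectation (\<lambda>\<omega>. a * Y i \<omega> * indicator B (A \<omega>))"
    by (simp add: mult.assoc)
  also have "\<dots> = a * (a / (a\<^sup>2 + b\<^sup>2 + c\<^sup>2) * expectation (\<lambda>\<omega>. A \<omega> * indicator B (A \<omega>)))"
    using indep_normal_sum_regression[OF a w aY W iW B]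
    by (simp add: A add.assoc power2_eq_square)
  finally show "expectation (\<lambda>\<omega>. Y i \<omega> * indicator B (A \<omega>)) =
      a / (a\<^sup>2 + b\<^sup>2 + c\<^sup>2) * expectation (\<lambda>\<omega>. A \<omega> * indicator B (A \<omega>))"
    using a by (subst (asm) mult_left_cancel) auto
qed

text \<open>Every event of the sigma-algebra generated by \<open>A\<close> is a preimage of some
  Borel set \<open>B\<close>, so \<open>eq\<close> is exactly the averaging property that identifies
  the conditional expectation.\<close>

lemma (in prob_space) real_cond_exp_vimage_linear:
  fixes A Q :: "'a \<Rightarrow> real"
  assumes [measurable]: "integrable M A" "integrable M Q"
    and eq: "\<And>B. B \<in> sets borel \<Longrightarrow> expectation (\<lambda>\<omega>. Q \<omega> * indicator B (A \<omega>)) =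
      \<kappa> * expectation (\<lambda>\<omega>. A \<omega> * indicator B (A \<omega>))"
  shows "AE \<omega> in M. real_cond_exp M (vimage_algebra (space M) A borel) Q \<omega> = \<kappa> * A \<omega>"
    and "real_cond_exp M (vimage_algebra (space M) A borel) Q \<in> borel_measurable M"
proof -
  let ?F = "vimage_algebra (space M) A borel"
  have [measurable]: "A \<in> borel_measurable M" by simp
  have sub: "subalgebra M ?F"
    unfolding subalgebra_def by (auto simp: sets_vimage_algebra2)
  interpret finite_measure_subalgebra M ?F
    by unfold_locales (rule sub)
  interpret sigma_finite_subalgebra M ?F
    by (rule finite_measure_subalgebra_is_sigma_finite) unfold_locales
  show "real_cond_exp M ?F Q \<in> borel_measurable M"
    by (rule borel_measurable_cond_exp2)
  show "AE \<omega> in M. real_cond_exp M ?F Q \<omega> = \<kappa> * A \<omega>"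
  proof (rule real_cond_exp_charact)
    fix S assume "S \<in> sets ?F"
    then obtain B where B: "B \<in> sets borel" "S = A -` B \<inter> space M"
      by (auto simp: sets_vimage_algebra2)
    have ind: "set_lebesgue_integral M S f = expectation (\<lambda>\<omega>. f \<omega> * indicator B (A \<omega>))" for f :: "'a \<Rightarrow> real"
      unfolding set_lebesgue_integral_def B(2)
      by (intro Bochner_Integration.integral_cong) (auto simp: indicator_def)
    show "set_lebesgue_integral M S Q = set_lebesgue_integral M S (\<lambda>\<omega>. \<kappa> * A \<omega>)"
      unfolding ind eq[OF B(1)] by (simp add: mult.assoc)
  next
    have "A \<in> borel_measurable ?F" by (rule measurable_vimage_algebra1) simp
    then show "(\<lambda>\<omega>. \<kappa> * A \<omega>) \<in> borel_measurable ?F" by simp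
  qed (use assms in auto)
qed

text \<open>Almost surely the admission rule reads \<tau> \<le> \<kappa> * A, and positivity of
  \<kappa> turns it into a threshold on \<open>A\<close>. Taking for \<open>B\<close> the ray above
  that threshold in \<open>eqX\<close> gives the average of \<open>X\<close>.\<close>

lemma (in prob_space) admitted_expectation_eq:
  fixes A Q X :: "'a \<Rightarrow> real"
  assumes A: "distributed M lborel A (normal_density 0 \<sigma>)" and \<sigma>: "0 < \<sigma>"
    and Q: "integrable M Q" and X[measurable]: "X \<in> borel_measurable M"
    and eqQ: "\<And>B. B \<in> sets borel \<Longrightarrow> expectation (\<lambda>\<omega>. Q \<omega> * indicator B (A \<omega>)) =
      \<kappa> * expectation (\<lambda>\<omega>. A \<omega> * indicator B (A \<omega>))"
    and eqX: "\<And>B. B \<in> sets borel \<Longrightarrow> expectation (\<lambda>\<omega>. X \<omega> * indicator B (A \<omega>)) =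
      m * expectation (\<lambda>\<omega>. A \<omega> * indicator B (A \<omega>))"
    and \<kappa>: "0 < \<kappa>"
  shows "event_expectation M X (admitted M A Q \<tau>) =
    m * event_expectation M A {\<omega> \<in> space M. \<tau> / \<kappa> \<le> A \<omega>}"
proof -
  have [measurable]: "A \<in> borel_measurable M" using distributed_measurable[OF A] by simp
  have intA: "integrable M A"
    using A by (rule distributed_integrable_var) (use integrable_normal_moment_nz_1[OF \<sigma>] in auto)
  note ce = real_cond_exp_vimage_linear[OF intA Q, of \<kappa>, OF eqQ]
  note ce(2)[measurable]
  define E where "E = {\<omega> \<in> space M. \<tau> / \<kappa> \<le> A \<omega>}"
  have [measurable]: "E \<in> sets M" unfolding E_def by measurable
  have "0 < prob {\<omega> \<in> space M. \<tau> / \<kappa> \<le> A \<omega> \<and> A \<omega> < \<tau> / \<kappa> + 1}"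
    by (rule normal_prob_interval_pos[OF A \<sigma>]) simp
  also have "\<dots> \<le> prob E"
    by (rule finite_measure_mono) (auto simp: E_def)
  finally have pos: "0 < prob E" .
  have ind: "expectation (\<lambda>\<omega>. f \<omega> * indicator E \<omega>) = expectation (\<lambda>\<omega>. f \<omega> * indicator {\<tau> / \<kappa>..} (A \<omega>))"
    for f :: "'a \<Rightarrow> real"
    by (intro Bochner_Integration.integral_cong) (auto simp: E_def indicator_def)
  have "event_expectation M X (admitted M A Q \<tau>) = event_expectation M X E"
  proof (rule event_expectation_cong_AE)
    show "admitted M A Q \<tau> \<in> sets M" unfolding admitted_def by measurable
    have "AE \<omega> in M. real_cond_exp M (vimage_algebra (space M) A borel) Q \<omega> = \<kappa> * A \<omega>"
      by (rule ce(1))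
    then show "AE \<omega> in M. \<omega> \<in> admitted M A Q \<tau> \<longleftrightarrow> \<omega> \<in> E"
      by eventually_elim (use \<kappa> in \<open>auto simp: admitted_def E_def pos_divide_le_eq mult.commute\<close>)
  qed (use prob_space_axioms in auto)
  also have "\<dots> = m * event_expectation M A E"
    using pos eqX[of "{\<tau> / \<kappa>..}"] by (simp add: event_expectation_eq prob_space_axioms ind)
  finally show ?thesis by (simp add: E_def)
qed

section \<open>Shape of the two averages\<close>

theorem theorem1:
  fixes M :: "'w measure" and t s Z :: "'w \<Rightarrow> real" and \<alpha> \<sigma>\<^sub>Z c :: real
  assumes "prob_space M"
    and "distributed M lborel t std_normal_density"
    and "distributed M lborel s std_normal_density"
    and "distributed M lborel Z std_normal_density"
    and "prob_space.indep_vars M (\<lambda>_. borel) (\<lambda>i. [t, s, Z] ! i) {..<3}"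
    and "0 < \<alpha>" and "\<alpha> < 1" and "0 \<le> \<sigma>\<^sub>Z" and "0 < c"
  defines "avg_type \<equiv> admitted_average M t s Z \<alpha> \<sigma>\<^sub>Z c t"
    and "avg_skill \<equiv> admitted_average M t s Z \<alpha> \<sigma>\<^sub>Z c s"
  shows "(\<forall>\<beta>\<in>{0<..<1}. avg_type \<alpha> \<le> avg_type \<beta>) \<and>
         strict_antimono_on {0<..\<alpha>} avg_type \<and> strict_mono_on {\<alpha>..<1} avg_type \<and>
         (\<forall>\<beta>\<in>{0<..<1}. avg_skill \<alpha> \<le> avg_skill \<beta>) \<and>
         strict_antimono_on {0<..\<alpha>} avg_skill \<and> strict_mono_on {\<alpha>..<1} avg_skill"
proof -
  interpret prob_space M by fact
  define A where "A = admission_score \<alpha> \<sigma>\<^sub>Z t s Z"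
  define v where "v = \<alpha>\<^sup>2 + (1 - \<alpha>)\<^sup>2 + \<sigma>\<^sub>Z\<^sup>2"
  have v: "0 < v" unfolding v_def using \<open>0 < \<alpha>\<close> by (simp add: add_pos_nonneg)
  define Y where "Y = (\<lambda>i. [t, s, Z] ! i)"
  \<comment> \<open>The component lemma singles out the first listed index. The two orders make it
    apply to the type and to the soft skill in turn.\<close>
  have idx: "{..<3} = {0, 1, 2::nat}" "{..<3} = {1, 0, 2::nat}" by auto
  have Y: "distributed M lborel (Y l) std_normal_density" if "l \<in> {..<3}" for l
    using that assms(2-4) by (auto simp: Y_def idx(1))
  have Asum: "A = (\<lambda>\<omega>. \<alpha> * Y 0 \<omega> + (1 - \<alpha>) * Y 1 \<omega> + \<sigma>\<^sub>Z * Y 2 \<omega>)"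
    "A = (\<lambda>\<omega>. (1 - \<alpha>) * Y 1 \<omega> + \<alpha> * Y 0 \<omega> + \<sigma>\<^sub>Z * Y 2 \<omega>)"
    by (auto simp: A_def admission_score_def Y_def)
  have vsum: "v = (1 - \<alpha>)\<^sup>2 + \<alpha>\<^sup>2 + \<sigma>\<^sub>Z\<^sup>2" by (simp add: v_def)
  have Y01: "t = Y 0" "s = Y 1" by (auto simp: Y_def)
  note indep = assms(5)[folded Y_def]
  note component0 = indep_std_normal_component[OF indep[unfolded idx(1)] _ _ _ Y[unfolded idx(1)]]
  note component1 = indep_std_normal_component[OF indep[unfolded idx(2)] _ _ _ Y[unfolded idx(2)]]
  have A: "distributed M lborel A (normal_density 0 (sqrt v))"
    unfolding Asum(1) v_def by (rule component0(1)) (use assms(6-8) in auto)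
  have [measurable]: "A \<in> borel_measurable M" using distributed_measurable[OF A] by simp
  have eqt: "expectation (\<lambda>\<omega>. t \<omega> * indicator B (A \<omega>)) = \<alpha> / v * expectation (\<lambda>\<omega>. A \<omega> * indicator B (A \<omega>))"
    if "B \<in> sets borel" for B
    unfolding Asum(1) v_def Y01 by (rule component0(2)) (use assms(6-8) that in auto)
  have eqs: "expectation (\<lambda>\<omega>. s \<omega> * indicator B (A \<omega>)) = (1 - \<alpha>) / v * expectation (\<lambda>\<omega>. A \<omega> * indicator B (A \<omega>))"
    if "B \<in> sets borel" for B
    unfolding Asum(2) vsum Y01 by (rule component1(2)) (use assms(6-8) that in auto)
  have int: "integrable M t" "integrable M s"
    using assms(2,3)[THEN distributed_integrable_var] integrable_normal_moment_nz_1[of 1 0] by auto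
  have intB: "integrable M (\<lambda>\<omega>. X \<omega> * indicator B (A \<omega>))"
    if "integrable M X" "B \<in> sets borel" for X :: "'w \<Rightarrow> real" and B
    by (rule Bochner_Integration.integrable_bound[OF that(1)]) (use that in \<open>auto simp: indicator_def\<close>)
  \<comment> \<open>The threshold on the score: the quality threshold
    \<open>c * quality_sd \<beta>\<close> divided by the regression factor
    \<open>alignment \<alpha> \<beta> / v\<close> of the quality.\<close>
  define \<theta> where "\<theta> = (\<lambda>\<beta>. c * v * (quality_sd \<beta> / alignment \<alpha> \<beta>))"
  define G where "G = (\<lambda>\<beta>. event_expectation M A {\<omega> \<in> space M. \<theta> \<beta> \<le> A \<omega>})"
  \<comment> \<open>The factor \<open>m\<close> does not depend on \<beta>, so the single function
    \<open>G\<close> carries the whole dependence of both averages on \<beta>.\<close>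
  have avg: "admitted_average M t s Z \<alpha> \<sigma>\<^sub>Z c X \<beta> = m * G \<beta>"
    if X: "integrable M X" and eqX: "\<And>B. B \<in> sets borel \<Longrightarrow> expectation (\<lambda>\<omega>. X \<omega> * indicator B (A \<omega>)) =
      m * expectation (\<lambda>\<omega>. A \<omega> * indicator B (A \<omega>))" and \<beta>: "0 < \<beta>" "\<beta> < 1" for X m \<beta>
  proof -
    have p: "0 < alignment \<alpha> \<beta>" using alignment_pos assms(6,7) \<beta> by simp
    have eqQ: "expectation (\<lambda>\<omega>. student_quality \<beta> t s \<omega> * indicator B (A \<omega>)) =
      alignment \<alpha> \<beta> / v * expectation (\<lambda>\<omega>. A \<omega> * indicator B (A \<omega>))" if B: "B \<in> sets borel" for B
    proof -
      have "expectation (\<lambda>\<omega>. student_quality \<beta> t s \<omega> * indicator B (A \<omega>)) =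
        expectation (\<lambda>\<omega>. \<beta> * (t \<omega> * indicator B (A \<omega>)) + (1 - \<beta>) * (s \<omega> * indicator B (A \<omega>)))"
        by (simp add: student_quality_def algebra_simps)
      also have "\<dots> = \<beta> * expectation (\<lambda>\<omega>. t \<omega> * indicator B (A \<omega>)) +
          (1 - \<beta>) * expectation (\<lambda>\<omega>. s \<omega> * indicator B (A \<omega>))"
        using intB[OF int(1) B] intB[OF int(2) B] by simp
      also have "\<dots> = alignment \<alpha> \<beta> / v * expectation (\<lambda>\<omega>. A \<omega> * indicator B (A \<omega>))"
        unfolding eqt[OF B] eqs[OF B] alignment_def using v by (simp add: field_simps)
      finally show ?thesis .
    qed
    have intQ: "integrable M (student_quality \<beta> t s)"
      unfolding student_quality_def[abs_def] using int by simp
    have "event_expectation M X (admitted M A (student_quality \<beta> t s) (c * quality_sd \<beta>)) =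
        m * event_expectation M A {\<omega> \<in> space M. c * quality_sd \<beta> / (alignment \<alpha> \<beta> / v) \<le> A \<omega>}"
      using X v p by (intro admitted_expectation_eq[OF A _ intQ] eqQ eqX) auto
    moreover have "c * quality_sd \<beta> / (alignment \<alpha> \<beta> / v) = \<theta> \<beta>"
      by (simp add: \<theta>_def)
    ultimately show ?thesis
      unfolding admitted_average_def A_def[symmetric] G_def by simp
  qed
  have G_less: "G x < G y"
      if "0 < x" "x < 1" "0 < y" "y < 1" "x < y \<and> \<alpha> \<le> x \<or> y < x \<and> x \<le> \<alpha>" for x y
  proof -
    have "\<theta> x < \<theta> y"
      unfolding \<theta>_def using v \<open>0 < c\<close>
      by (intro mult_strict_left_mono quality_sd_over_alignment_less[OF assms(6,7) that]) simp
    then show ?thesis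
      unfolding G_def using v by (intro normal_tail_expectation_strict_mono[OF A]) auto
  qed
  \<comment> \<open>Stated for any positive multiple of \<open>G\<close> to serve both averages,
    with \<open>m\<close> equal to \<open>\<alpha> / v\<close> and
    \<open>(1 - \<alpha>) / v\<close>. Agreement on the open unit interval is enough, since it
    contains both half-intervals.\<close>
  have shape: "(\<forall>\<beta>\<in>{0<..<1}. f \<alpha> \<le> f \<beta>) \<and> strict_antimono_on {0<..\<alpha>} f \<and> strict_mono_on {\<alpha>..<1} f"
    if f: "\<And>\<beta>. 0 < \<beta> \<Longrightarrow> \<beta> < 1 \<Longrightarrow> f \<beta> = m * G \<beta>" and m: "0 < m" for f m
  proof -
    have less: "f x < f y"
      if "0 < x" "x < 1" "0 < y" "y < 1" "x < y \<and> \<alpha> \<le> x \<or> y < x \<and> x \<le> \<alpha>" for x y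
      using G_less[OF that] m by (simp add: f that)
    \<comment> \<open>Both alternatives in \<open>less\<close> allow \<open>x\<close> to be
      \<alpha>, so minimality comes from the same comparison.\<close>
    have "f \<alpha> \<le> f \<beta>" if "\<beta> \<in> {0<..<1}" for \<beta>
      using less[of \<alpha> \<beta>] that assms(6,7) by (cases \<alpha> \<beta> rule: linorder_cases) auto
    then show ?thesis
      using less assms(6,7) by (auto simp: monotone_on_def)
  qed
  have "(\<forall>\<beta>\<in>{0<..<1}. avg_type \<alpha> \<le> avg_type \<beta>)
      \<and> strict_antimono_on {0<..\<alpha>} avg_type \<and> strict_mono_on {\<alpha>..<1} avg_type"
    unfolding avg_type_def using avg[OF int(1) eqt] v \<open>0 < \<alpha>\<close> by (intro shape[of _ "\<alpha> / v"]) auto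
  moreover have "(\<forall>\<beta>\<in>{0<..<1}. avg_skill \<alpha> \<le> avg_skill \<beta>)
      \<and> strict_antimono_on {0<..\<alpha>} avg_skill \<and> strict_mono_on {\<alpha>..<1} avg_skill"
    unfolding avg_skill_def using avg[OF int(2) eqs] v \<open>\<alpha> < 1\<close>
      by (intro shape[of _ "(1 - \<alpha>) / v"]) auto
  ultimately show ?thesis by blast
qed

end
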